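(* The map $T$ (defined in the context) fulfills the data processing inequality, i.e., $T(\mathbf{Y},\mathbf{Z})\le T(\mathbf{Y},\mathbf{X})$ for all $\mathbf{X},\mathbf{Y},\mathbf{Z}$ such that $\mathbf{Y}$ and $\mathbf{Z}$ are conditionally independent given $\mathbf{X}$. In particular, $T(\mathbf{Y},\mathbf{h}(\mathbf{X}))\le T(\mathbf{Y},\mathbf{X})$ for all $\mathbf{X},\mathbf{Y}$ and all measurable functions $\mathbf{h}$.
   Context: All random vectors are defined on a common probability space $(\Omega,\mathcal{A},P)$: $\mathbf{X}=(X_1,\dots,X_p)$, $\mathbf{Y}=(Y_1,\dots,Y_q)$, $\mathbf{Z}=(Z_1,\dots,Z_r)$ with arbitrary $p,q,r\in\{1,2,\dots\}$. The components of $\mathbf{Y}$ are non-degenerate, i.e., no $Y_i$ is almost surely constant. For a non-degenerate real random variable $Y$ and a random vector $\mathbf{X}$ put $$\xi(Y,\mathbf{X}):=\frac{\int_{\mathbb{R}}\mathrm{Var}\big(P(Y\ge y\mid\mathbf{X})\big)\,\mathrm{d}P^{Y}(y)}{\int_{\mathbb{R}}\mathrm{Var}\big(\mathbf{1}_{\{Y\ge y\}}\big)\,\mathrm{d}P^{Y}(y)},$$ where $P^Y$ is the distribution of $Y$. Then $$T(\mathbf{Y},\mathbf{X}):=1-\frac{q-\sum_{i=1}^{q}\xi\big(Y_i,(\mathbf{X},Y_{i-1},\dots,Y_1)\big)}{q-\sum_{i=1}^{q}\xi\big(Y_i,(Y_{i-1},\dots,Y_1)\big)},\qquad \xi(Y_1,\emptyset):=0,$$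 where for $i=1$ the vector $(\mathbf{X},Y_{i-1},\dots,Y_1)$ is $\mathbf{X}$ and $(Y_{i-1},\dots,Y_1)$ is empty. *)

theory Defs
  imports "HOL-Probability.Probability"
begin

text \<open>Points of real \<open>n\<close>-space are functions on the index set \<open>{1..n}\<close> (extensional, as usual
  for \<open>PiM\<close>), since the dimensions of the conditioning vectors vary within one formula. For
  \<open>n = 0\<close> this is a one-point space.\<close>

abbreviation Rn :: "nat \<Rightarrow> (nat \<Rightarrow> real) measure" where
  "Rn n \<equiv> PiM {1..n} (\<lambda>_. borel)"

definition generated_algebra :: "'a measure \<Rightarrow> nat \<Rightarrow> ('a \<Rightarrow> nat \<Rightarrow> real) \<Rightarrow> 'a measure" where
  "generated_algebra M n V = vimage_algebra (space M) V (Rn n)"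

text \<open>\<open>P(A | V)\<close>, as a random variable determined up to null sets; \<open>n\<close> is the dimension
  of \<open>V\<close>.\<close>

definition cprob :: "'a measure \<Rightarrow> 'a set \<Rightarrow> nat \<Rightarrow> ('a \<Rightarrow> nat \<Rightarrow> real) \<Rightarrow> 'a \<Rightarrow> real" where
  "cprob M A n V = real_cond_exp M (generated_algebra M n V) (indicator A)"

definition cond_indep ::
  "'a measure \<Rightarrow> nat \<Rightarrow> ('a \<Rightarrow> nat \<Rightarrow> real) \<Rightarrow> nat \<Rightarrow> ('a \<Rightarrow> nat \<Rightarrow> real)
    \<Rightarrow> nat \<Rightarrow> ('a \<Rightarrow> nat \<Rightarrow> real) \<Rightarrow> bool" where
  "cond_indep M q Y r Z p X \<longleftrightarrow>
    (\<forall>A \<in> sets (generated_algebra M q Y). \<forall>B \<in> sets (generated_algebra M r Z).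
      AE \<omega> in M. cprob M (A \<inter> B) p X \<omega> = cprob M A p X \<omega> * cprob M B p X \<omega>)"

definition nondegenerate :: "'a measure \<Rightarrow> ('a \<Rightarrow> real) \<Rightarrow> bool" where
  "nondegenerate M U \<longleftrightarrow> \<not> (\<exists>c. AE \<omega> in M. U \<omega> = c)"

definition xi :: "'a measure \<Rightarrow> ('a \<Rightarrow> real) \<Rightarrow> nat \<Rightarrow> ('a \<Rightarrow> nat \<Rightarrow> real) \<Rightarrow> real" where
  "xi M U n V =
    (\<integral>y. prob_space.variance M (cprob M {\<omega> \<in> space M. U \<omega> \<ge> y} n V) \<partial>distr M borel U) /
    (\<integral>y. prob_space.variance M (indicator {\<omega> \<in> space M. U \<omega> \<ge> y}) \<partial>distr M borel U)"

text \<open>\<open>(Y\<^sub>i\<^sub>-\<^sub>1, \<dots>, Y\<^sub>1)\<close>, of dimension \<open>i - 1\<close>, and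
  \<open>(X, Y\<^sub>i\<^sub>-\<^sub>1, \<dots>, Y\<^sub>1)\<close>, of dimension \<open>p + (i - 1)\<close>, for \<open>i \<ge> 1\<close>.\<close>

definition preceding :: "nat \<Rightarrow> ('a \<Rightarrow> nat \<Rightarrow> real) \<Rightarrow> 'a \<Rightarrow> nat \<Rightarrow> real" where
  "preceding i Y \<omega> = (\<lambda>j\<in>{1..i - 1}. Y \<omega> (i - j))"

definition with_preceding ::
  "nat \<Rightarrow> ('a \<Rightarrow> nat \<Rightarrow> real) \<Rightarrow> nat \<Rightarrow> ('a \<Rightarrow> nat \<Rightarrow> real) \<Rightarrow> 'a \<Rightarrow> nat \<Rightarrow> real" where
  "with_preceding p X i Y \<omega> =
    (\<lambda>j\<in>{1..p + (i - 1)}. if j \<le> p then X \<omega> j else preceding i Y \<omega> (j - p))"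

text \<open>\<open>T(Y, X)\<close>. The \<open>if\<close> is the convention that \<open>\<xi>(Y\<^sub>1, \<emptyset>) = 0\<close>.\<close>

definition T_dep ::
  "'a measure \<Rightarrow> nat \<Rightarrow> ('a \<Rightarrow> nat \<Rightarrow> real) \<Rightarrow> nat \<Rightarrow> ('a \<Rightarrow> nat \<Rightarrow> real) \<Rightarrow> real" where
  "T_dep M q Y p X =
    1 - (real q - (\<Sum>i = 1..q. xi M (\<lambda>\<omega>. Y \<omega> i) (p + (i - 1)) (with_preceding p X i Y))) /
        (real q - (\<Sum>i = 1..q. if i = 1 then 0
                               else xi M (\<lambda>\<omega>. Y \<omega> i) (i - 1) (preceding i Y)))"

end

theory Submission
  imports Defs
begin

text \<open>Fix \<open>i\<close> and an event \<open>A = {Y\<^sub>i \<ge> y}\<close>. If \<open>Y\<close> and \<open>Z\<close> are conditionally independent given \<open>X\<close>,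
  then adding preceding components of \<open>Y\<close> to the condition \<open>X\<close> does not change the conditional
  law of \<open>Z\<close>. Hence \<open>P(A | Z, Y\<^sub><\<^sub>i)\<close> is the conditional expectation of \<open>P(A | X, Y\<^sub><\<^sub>i)\<close> given
  \<open>(Z, Y\<^sub><\<^sub>i)\<close>, although \<open>(Z, Y\<^sub><\<^sub>i)\<close> need not be a function of \<open>(X, Y\<^sub><\<^sub>i)\<close>. Conditional expectations
  contract variances, so every summand \<open>\<xi>\<close> in the numerator decreases when \<open>X\<close> is replaced by
  \<open>Z\<close>; the denominator of \<open>T\<close> does not involve \<open>X\<close> and is nonnegative because \<open>\<xi> \<le> 1\<close>.\<close>

section \<open>Testing and bounding conditional expectations\<close>

text \<open>A Dynkin argument: the sets on which both integrals agree are closed under countable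
  disjoint unions, by countable additivity, and under complements, because \<open>space M\<close>
  belongs to \<open>E\<close> and so the total integrals agree. Since \<open>f\<close> and
  \<open>g\<close> may change sign, the argument runs on signed integrals.\<close>

lemma set_integral_eq_generator:
  fixes f g :: "'a \<Rightarrow> real"
  assumes f: "integrable M f" and g: "integrable M g"
    and E: "Int_stable E" "E \<subseteq> sets M" "space M \<in> E"
    and eq: "\<And>A. A \<in> E \<Longrightarrow> (\<integral>x\<in>A. f x \<partial>M) = (\<integral>x\<in>A. g x \<partial>M)"
    and A: "A \<in> sigma_sets (space M) E"
  shows "(\<integral>x\<in>A. f x \<partial>M) = (\<integral>x\<in>A. g x \<partial>M)"
proof -
  have sub: "E \<subseteq> Pow (space M)"
    using E(2) sets.space_closed by blast
  have M: "B \<in> sets M" if "B \<in> sigma_sets (space M) E" for B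
    using that E(2) sets.sigma_sets_subset by blast
  have int: "set_integrable M B h" if "integrable M h" "B \<in> sets M" for B and h :: "'a \<Rightarrow> real"
    unfolding set_integrable_def using that by (intro integrable_mult_indicator)
  show ?thesis
    using E(1) sub A
  proof (induction rule: sigma_sets_induct_disjoint)
    case (basic B)
    then show ?case by (rule eq)
  next
    case empty
    show ?case by (simp add: set_lebesgue_integral_def)
  next
    case (compl B)
    have *: "(\<integral>x\<in>space M - B. h x \<partial>M) = (\<integral>x\<in>space M. h x \<partial>M) - (\<integral>x\<in>B. h x \<partial>M)"
      if h: "integrable M h" for h :: "'a \<Rightarrow> real"
    proof -
      have B: "B \<in> sets M" by (rule M) fact
      have "(\<integral>x\<in>(space M - B) \<union> B. h x \<partial>M) = (\<integral>x\<in>space M - B. h x \<partial>M) + (\<integral>x\<in>B. h x \<partial>M)"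
        using B by (intro set_integral_Un int h) auto
      moreover have "(space M - B) \<union> B = space M" using sets.sets_into_space[OF B] by auto
      ultimately show ?thesis by simp
    qed
    show ?case using compl.IH eq[OF E(3)] by (simp add: *[OF f] *[OF g])
  next
    case (union B)
    have *: "(\<integral>x\<in>(\<Union>i. B i). h x \<partial>M) = (\<Sum>i. (\<integral>x\<in>B i. h x \<partial>M))"
      if h: "integrable M h" for h :: "'a \<Rightarrow> real"
    proof (rule lebesgue_integral_countable_add)
      show "B i \<in> sets M" for i using union M by auto
      then show "set_integrable M (\<Union>i. B i) h" by (intro int h) auto
      show "\<And>i j. i \<noteq> j \<Longrightarrow> B i \<inter> B j = {}" using union(1) by (auto simp: disjoint_family_on_def)
    qed
    show ?case using union by (simp add: *[OF f] *[OF g])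
  qed
qed

lemma (in prob_space) sigma_finite_subalgebraI:
  "subalgebra M F \<Longrightarrow> sigma_finite_subalgebra M F"
  by (intro finite_measure_subalgebra_is_sigma_finite finite_measure_subalgebra.intro
      finite_measure_subalgebra_axioms.intro) unfold_locales

text \<open>The test sets \<open>E\<close> generate a sigma-algebra that contains \<open>F\<close>;
  they need not belong to \<open>F\<close> themselves.\<close>

lemma (in sigma_finite_subalgebra) real_cond_exp_charact_generator:
  assumes E: "Int_stable E" "E \<subseteq> sets M" "space M \<in> E" "sets F \<subseteq> sigma_sets (space M) E"
    and eq: "\<And>A. A \<in> E \<Longrightarrow> (\<integral>x\<in>A. f x \<partial>M) = (\<integral>x\<in>A. g x \<partial>M)"
    and int: "integrable M f" "integrable M g" and g: "g \<in> borel_measurable F"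
  shows "AE x in M. real_cond_exp M F f x = g x"
  using set_integral_eq_generator[OF int E(1-3) eq] E(4) int g
  by (intro real_cond_exp_charact) auto

lemma (in prob_space) real_cond_exp_indicator_bounds:
  assumes "subalgebra M F" "A \<in> events"
  shows "AE x in M. 0 \<le> real_cond_exp M F (indicator A) x \<and> real_cond_exp M F (indicator A) x \<le> 1"
proof -
  interpret F: sigma_finite_subalgebra M F by (rule sigma_finite_subalgebraI) fact
  have i: "integrable M (indicator A :: 'a \<Rightarrow> real)" using assms by (simp add: emeasure_eq_measure)
  have "AE x in M. real_cond_exp M F (indicator A) x \<ge> 0"
    using assms by (intro F.real_cond_exp_pos) auto
  moreover have "AE x in M. real_cond_exp M F (indicator A) x \<le> 1"
    by (rule F.real_cond_exp_le_c[OF i]) (auto simp: indicator_def)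
  ultimately show ?thesis by auto
qed

lemma (in prob_space) integrable_bounded_AE:
  fixes f :: "'a \<Rightarrow> real"
  assumes "f \<in> borel_measurable M" "AE x in M. 0 \<le> f x \<and> f x \<le> 1"
  shows "integrable M f"
  by (rule integrable_const_bound[of _ 1]) (use assms in auto)

text \<open>This is the exchange rule for the integral computations below: against an
  \<open>F\<close>-measurable weight, an indicator and its conditional probability are
  interchangeable. The bounds on the weight hold almost everywhere because weights are often
  conditional probabilities, fixed only up to null sets.\<close>

lemma (in prob_space) integral_cond_exp_indicator_mult:
  assumes F: "subalgebra M F" and A: "A \<in> events"
    and f: "f \<in> borel_measurable F" "AE x in M. 0 \<le> f x \<and> f x \<le> 1"
  shows "(\<integral>x. f x * real_cond_exp M F (indicator A) x \<partial>M) = (\<integral>x. f x * indicator A x \<partial>M)"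
proof (rule sigma_finite_subalgebra.real_cond_exp_intg(2)[OF sigma_finite_subalgebraI[OF F]])
  have [measurable]: "f \<in> borel_measurable M" by (rule measurable_from_subalg[OF F f(1)])
  show "integrable M (\<lambda>x. f x * indicator A x)"
    using f(2) A by (intro integrable_bounded_AE) (auto simp: indicator_def)
qed (use f A in auto)

text \<open>Conditional expectation is an orthogonal projection: with \<open>v\<close> the
  conditional expectation of \<open>w\<close>, E(v w) = E(v^2), hence 0 \<le> E((w - v)^2) = E(w^2)
  - E(v^2).\<close>

lemma (in prob_space) energy_real_cond_exp_le:
  assumes F: "subalgebra M F"
    and w: "w \<in> borel_measurable M" "AE x in M. 0 \<le> w x \<and> w x \<le> 1"
  shows "(\<integral>x. (real_cond_exp M F w x)\<^sup>2 \<partial>M) \<le> (\<integral>x. (w x)\<^sup>2 \<partial>M)"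
proof -
  interpret F: sigma_finite_subalgebra M F by (rule sigma_finite_subalgebraI) fact
  note [measurable] = w(1)
  have i: "integrable M w" using w by (rule integrable_bounded_AE)
  define v where "v = real_cond_exp M F w"
  have [measurable]: "v \<in> borel_measurable M" "v \<in> borel_measurable F" by (auto simp: v_def)
  have "AE x in M. v x \<ge> 0" using w unfolding v_def by (intro F.real_cond_exp_pos) auto
  moreover have "AE x in M. v x \<le> 1" unfolding v_def
    by (rule F.real_cond_exp_le_c[OF i]) (use w in auto)
  ultimately have v: "AE x in M. 0 \<le> v x \<and> v x \<le> 1" by auto
  have vw: "integrable M (\<lambda>x. v x * w x)"
    using v w(2) by (intro integrable_bounded_AE) (auto intro: mult_le_one)
  have v2: "integrable M (\<lambda>x. (v x)\<^sup>2)"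
    using v by (intro integrable_bounded_AE) (auto intro: power_le_one)
  have w2: "integrable M (\<lambda>x. (w x)\<^sup>2)"
    using w by (intro integrable_bounded_AE) (auto intro: power_le_one)
  have "(\<integral>x. (v x)\<^sup>2 \<partial>M) = (\<integral>x. v x * w x \<partial>M)"
    using F.real_cond_exp_intg(2)[OF vw] by (simp add: v_def power2_eq_square)
  moreover have "0 \<le> (\<integral>x. (w x - v x)\<^sup>2 \<partial>M)" by simp
  moreover have "(\<integral>x. (w x - v x)\<^sup>2 \<partial>M)
      = (\<integral>x. (w x)\<^sup>2 \<partial>M) - 2 * (\<integral>x. v x * w x \<partial>M) + (\<integral>x. (v x)\<^sup>2 \<partial>M)"
  proof -
    have "(\<lambda>x. (w x - v x)\<^sup>2) = (\<lambda>x. (w x)\<^sup>2 - 2 * (v x * w x) + (v x)\<^sup>2)"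
      by (simp add: fun_eq_iff power2_diff)
    then show ?thesis using vw v2 w2 by simp
  qed
  ultimately show ?thesis unfolding v_def by linarith
qed

section \<open>Conditional independence of sigma-algebras\<close>

text \<open>On a common space these sets form an intersection-stable generator of the join of
  \<open>F\<close> and \<open>G\<close>, so integral identities on the join need testing only
  here.\<close>

definition rectangles :: "'a measure \<Rightarrow> 'a measure \<Rightarrow> 'a set set" where
  "rectangles F G = {A \<inter> B | A B. A \<in> sets F \<and> B \<in> sets G}"

lemma Int_stable_rectangles: "Int_stable (rectangles F G)"
proof (rule Int_stableI)
  fix a b assume "a \<in> rectangles F G" "b \<in> rectangles F G"
  then obtain A B A' B' where "a = A \<inter> B" "b = A' \<inter> B'"
    "A \<in> sets F" "B \<in> sets G" "A' \<in> sets F" "B' \<in> sets G" by (auto simp: rectangles_def)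
  moreover have "(A \<inter> B) \<inter> (A' \<inter> B') = (A \<inter> A') \<inter> (B \<inter> B')" by auto
  ultimately show "a \<inter> b \<in> rectangles F G" unfolding rectangles_def by blast
qed

lemma rectangles_subset:
  "subalgebra M F \<Longrightarrow> subalgebra M G \<Longrightarrow> rectangles F G \<subseteq> sets M"
  by (auto simp: rectangles_def subalgebra_def)

lemma space_in_rectangles:
  "subalgebra M F \<Longrightarrow> subalgebra M G \<Longrightarrow> space M \<in> rectangles F G"
  unfolding rectangles_def subalgebra_def
  by (intro CollectI exI[of _ "space M"]) (metis Int_absorb sets.top)

locale cond_indep_algebras = prob_space M
  for M :: "'a measure" and FX FY FZ :: "'a measure" +
  assumes FX: "subalgebra M FX" and FY: "subalgebra M FY" and FZ: "subalgebra M FZ"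
    and indep: "\<And>A B. A \<in> sets FY \<Longrightarrow> B \<in> sets FZ \<Longrightarrow>
      AE x in M. real_cond_exp M FX (indicator (A \<inter> B)) x
        = real_cond_exp M FX (indicator A) x * real_cond_exp M FX (indicator B) x"
begin

text \<open>Information from \<open>FY\<close> adds nothing about \<open>FZ\<close> once
  \<open>FX\<close> is known. On D \<inter> C the integral of the indicator of \<open>B\<close> is
  that of P(C \<inter> B | \<open>FX\<close>) over \<open>D\<close>. Conditional independence
  factors this, and P(C | \<open>FX\<close>) then turns back into the indicator of \<open>C\<close>,
  because the remaining weight is \<open>FX\<close>-measurable.\<close>

lemma real_cond_exp_enlarge:
  assumes FC: "subalgebra FY FC"
    and H: "subalgebra M H" "sets FX \<subseteq> sets H" "sets H \<subseteq> sigma_sets (space M) (rectangles FX FC)"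
    and B: "B \<in> sets FZ"
  shows "AE x in M. real_cond_exp M H (indicator B) x = real_cond_exp M FX (indicator B) x"
proof -
  interpret H: sigma_finite_subalgebra M H by (rule sigma_finite_subalgebraI) fact
  interpret X: sigma_finite_subalgebra M FX by (rule sigma_finite_subalgebraI) (rule FX)
  have MC: "subalgebra M FC" using FC FY by (auto simp: subalgebra_def)
  have Bm[measurable]: "B \<in> events" using B FZ by (auto simp: subalgebra_def)
  define b where "b = real_cond_exp M FX (indicator B)"
  have bX[measurable]: "b \<in> borel_measurable FX" and [measurable]: "b \<in> borel_measurable M"
    by (auto simp: b_def)
  have b01: "AE x in M. 0 \<le> b x \<and> b x \<le> 1"
    unfolding b_def by (rule real_cond_exp_indicator_bounds[OF FX Bm])
  have "AE x in M. real_cond_exp M H (indicator B) x = b x"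
  proof (rule H.real_cond_exp_charact_generator[OF Int_stable_rectangles
        rectangles_subset[OF FX MC] space_in_rectangles[OF FX MC] H(3)])
    fix R assume "R \<in> rectangles FX FC"
    then obtain D C where R: "R = D \<inter> C" and D[measurable]: "D \<in> sets FX" and C: "C \<in> sets FC"
      by (auto simp: rectangles_def)
    have CY: "C \<in> sets FY" using C FC by (auto simp: subalgebra_def)
    then have Cm[measurable]: "C \<in> events" using FY by (auto simp: subalgebra_def)
    have Dm: "D \<in> events" using D FX by (auto simp: subalgebra_def)
    have "(\<integral>x\<in>R. indicat_real B x \<partial>M) = (\<integral>x. indicator D x * indicator (C \<inter> B) x \<partial>M)"
      unfolding set_lebesgue_integral_def R
      by (intro Bochner_Integration.integral_cong) (auto simp: indicator_def)
    also have "\<dots> = (\<integral>x. indicator D x * real_cond_exp M FX (indicator (C \<inter> B)) x \<partial>M)"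
      by (intro integral_cond_exp_indicator_mult[symmetric] FX) (auto simp: indicator_def)
    also have "\<dots> = (\<integral>x. (indicator D x * b x) * real_cond_exp M FX (indicator C) x \<partial>M)"
      using indep[OF CY B] Dm by (intro integral_cong_AE) (auto simp: b_def)
    also have "\<dots> = (\<integral>x. (indicator D x * b x) * indicator C x \<partial>M)"
      using b01 by (intro integral_cond_exp_indicator_mult FX) (auto simp: indicator_def)
    also have "\<dots> = (\<integral>x\<in>R. b x \<partial>M)"
      unfolding set_lebesgue_integral_def R
      by (intro Bochner_Integration.integral_cong) (auto simp: indicator_def)
    finally show "(\<integral>x\<in>R. indicat_real B x \<partial>M) = (\<integral>x\<in>R. b x \<partial>M)" .
  next
    show "integrable M (indicator B :: 'a \<Rightarrow> real)" by (simp add: emeasure_eq_measure)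
    show "integrable M b" using b01 by (intro integrable_bounded_AE) auto
    show "b \<in> borel_measurable H"
      using bX H(1,2) FX by (auto intro!: measurable_from_subalg[of H FX] simp: subalgebra_def)
  qed
  then show ?thesis by (simp add: b_def)
qed

text \<open>The usual tower property does not apply, as \<open>G\<close> need not lie in
  \<open>H\<close>. On a rectangle B \<inter> C the detour is to replace the indicator of
  \<open>B\<close> by P(B | \<open>FX\<close>), which is \<open>H\<close>-measurable, then pass from
  the indicator of \<open>A\<close> to P(A | \<open>H\<close>), and finally restore
  \<open>B\<close>.\<close>

lemma real_cond_exp_tower:
  assumes FC: "subalgebra FY FC"
    and H: "subalgebra M H" "sets FX \<subseteq> sets H" "sets FC \<subseteq> sets H"
      "sets H \<subseteq> sigma_sets (space M) (rectangles FX FC)"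
    and G: "subalgebra M G" "sets G \<subseteq> sigma_sets (space M) (rectangles FZ FC)"
    and A: "A \<in> sets FY"
  shows "AE x in M. real_cond_exp M G (indicator A) x
    = real_cond_exp M G (real_cond_exp M H (indicator A)) x"
proof -
  interpret G: sigma_finite_subalgebra M G by (rule sigma_finite_subalgebraI) fact
  have MC: "subalgebra M FC" using FC FY by (auto simp: subalgebra_def)
  have Am[measurable]: "A \<in> events" using A FY by (auto simp: subalgebra_def)
  define a where "a = real_cond_exp M H (indicator A)"
  have [measurable]: "a \<in> borel_measurable H" "a \<in> borel_measurable M" by (auto simp: a_def)
  have a01: "AE x in M. 0 \<le> a x \<and> a x \<le> 1"
    unfolding a_def by (rule real_cond_exp_indicator_bounds[OF H(1) Am])
  have ia: "integrable M a" using a01 by (intro integrable_bounded_AE) auto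
  have iA: "integrable M (indicator A :: 'a \<Rightarrow> real)" by (simp add: emeasure_eq_measure)
  have rect: "(\<integral>x\<in>R. indicat_real A x \<partial>M) = (\<integral>x\<in>R. a x \<partial>M)" if RR: "R \<in> rectangles FZ FC" for R
  proof -
    obtain B C where R: "R = B \<inter> C" and B: "B \<in> sets FZ" and C: "C \<in> sets FC"
      using RR by (auto simp: rectangles_def)
    have CY: "C \<in> sets FY" using C FC by (auto simp: subalgebra_def)
    have CH[measurable]: "C \<in> sets H" using C H by auto
    have Bm[measurable]: "B \<in> events" using B FZ by (auto simp: subalgebra_def)
    have Cm[measurable]: "C \<in> events" using CY FY by (auto simp: subalgebra_def)
    have AC: "A \<inter> C \<in> sets FY" using A CY by auto
    define b where "b = real_cond_exp M FX (indicator B)"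
    have bX[measurable]: "b \<in> borel_measurable FX" and [measurable]: "b \<in> borel_measurable M"
      by (auto simp: b_def)
    have bH[measurable]: "b \<in> borel_measurable H"
      using bX H(1,2) FX by (auto intro!: measurable_from_subalg[of H FX] simp: subalgebra_def)
    have b01: "AE x in M. 0 \<le> b x \<and> b x \<le> 1"
      unfolding b_def by (rule real_cond_exp_indicator_bounds[OF FX Bm])
    \<comment> \<open>The factor 1 is the constant weight in the exchange rule
      \<open>integral_cond_exp_indicator_mult\<close>. Grouping A \<inter> C gives an event of
      \<open>FY\<close>, to which \<open>indep\<close> applies.\<close>
    have "(\<integral>x\<in>R. indicat_real A x \<partial>M) = (\<integral>x. 1 * indicator ((A \<inter> C) \<inter> B) x \<partial>M)"
      unfolding set_lebesgue_integral_def R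
      by (intro Bochner_Integration.integral_cong) (auto simp: indicator_def)
    also have "\<dots> = (\<integral>x. 1 * real_cond_exp M FX (indicator ((A \<inter> C) \<inter> B)) x \<partial>M)"
      by (intro integral_cond_exp_indicator_mult[symmetric] FX) auto
    also have "\<dots> = (\<integral>x. b x * real_cond_exp M FX (indicator (A \<inter> C)) x \<partial>M)"
      using indep[OF AC B] by (intro integral_cong_AE) (auto simp: b_def)
    also have "\<dots> = (\<integral>x. b x * indicator (A \<inter> C) x \<partial>M)"
      using b01 by (intro integral_cond_exp_indicator_mult FX) auto
    also have "\<dots> = (\<integral>x. (indicator C x * b x) * indicator A x \<partial>M)"
      by (intro Bochner_Integration.integral_cong) (auto simp: indicator_def)
    also have "\<dots> = (\<integral>x. (indicator C x * b x) * a x \<partial>M)"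
      using b01 unfolding a_def
      by (intro integral_cond_exp_indicator_mult[symmetric] H) (auto simp: indicator_def)
    \<comment> \<open>By \<open>real_cond_exp_enlarge\<close>, \<open>b\<close> is also the
      conditional probability of \<open>B\<close> given \<open>H\<close>. Now \<open>a\<close> joins
      the \<open>H\<close>-measurable weight, and \<open>b\<close> can be exchanged for the
      indicator of \<open>B\<close>.\<close>
    also have "\<dots> = (\<integral>x. (indicator C x * a x) * real_cond_exp M H (indicator B) x \<partial>M)"
      using real_cond_exp_enlarge[OF FC H(1,2,4) B] by (intro integral_cong_AE) (auto simp: b_def)
    also have "\<dots> = (\<integral>x. (indicator C x * a x) * indicator B x \<partial>M)"
      using a01 by (intro integral_cond_exp_indicator_mult H) (auto simp: indicator_def)
    also have "\<dots> = (\<integral>x\<in>R. a x \<partial>M)"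
      unfolding set_lebesgue_integral_def R
      by (intro Bochner_Integration.integral_cong) (auto simp: indicator_def)
    finally show ?thesis .
  qed
  have "AE x in M. real_cond_exp M G (indicator A) x = real_cond_exp M G a x"
  proof (rule G.real_cond_exp_charact)
    fix S assume S: "S \<in> sets G"
    have "(\<integral>x\<in>S. indicat_real A x \<partial>M) = (\<integral>x\<in>S. a x \<partial>M)"
      using S G(2)
      by (intro set_integral_eq_generator[OF iA ia Int_stable_rectangles
            rectangles_subset[OF FZ MC] space_in_rectangles[OF FZ MC] rect]) auto
    also have "\<dots> = (\<integral>x\<in>S. real_cond_exp M G a x \<partial>M)"
      by (rule G.real_cond_exp_intA[OF ia S])
    finally show "(\<integral>x\<in>S. indicat_real A x \<partial>M) = (\<integral>x\<in>S. real_cond_exp M G a x \<partial>M)" .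
  qed (use ia iA G.real_cond_exp_int in auto)
  then show ?thesis by (simp add: a_def)
qed

end

section \<open>Variances of conditional probabilities\<close>

text \<open>The mean is \<open>prob A\<close> whatever \<open>F\<close> is, so comparing variances
  for different sigma-algebras amounts to comparing second moments.\<close>

lemma (in prob_space) variance_real_cond_exp_indicator:
  assumes F: "subalgebra M F" and A: "A \<in> events"
  shows "variance (real_cond_exp M F (indicator A))
    = (\<integral>x. (real_cond_exp M F (indicator A) x)\<^sup>2 \<partial>M) - (prob A)\<^sup>2"
proof -
  interpret F: sigma_finite_subalgebra M F by (rule sigma_finite_subalgebraI) fact
  note b = real_cond_exp_indicator_bounds[OF F A]
  have "integrable M (real_cond_exp M F (indicator A))"
    using b by (intro integrable_bounded_AE) auto
  moreover have "integrable M (\<lambda>x. (real_cond_exp M F (indicator A) x)\<^sup>2)"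
    using b by (intro integrable_bounded_AE) (auto intro: power_le_one)
  moreover have "expectation (real_cond_exp M F (indicator A)) = prob A"
    using A by (subst F.real_cond_exp_int(2)) (auto simp: emeasure_eq_measure)
  ultimately show ?thesis by (subst variance_eq) auto
qed

lemma (in prob_space) variance_indicator:
  assumes A: "A \<in> events"
  shows "variance (indicator A) = prob A - (prob A)\<^sup>2"
proof -
  have sq: "(\<lambda>x. (indicator A x :: real)\<^sup>2) = indicator A" by (auto simp: indicator_def)
  show ?thesis using A by (subst variance_eq) (auto simp: sq emeasure_eq_measure)
qed

lemma (in cond_indep_algebras) variance_real_cond_exp_le:
  assumes FC: "subalgebra FY FC"
    and H: "subalgebra M H" "sets FX \<subseteq> sets H" "sets FC \<subseteq> sets H"
      "sets H \<subseteq> sigma_sets (space M) (rectangles FX FC)"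
    and G: "subalgebra M G" "sets G \<subseteq> sigma_sets (space M) (rectangles FZ FC)"
    and A: "A \<in> sets FY"
  shows "variance (real_cond_exp M G (indicator A)) \<le> variance (real_cond_exp M H (indicator A))"
proof -
  have Am: "A \<in> events" using A FY by (auto simp: subalgebra_def)
  have "(\<integral>x. (real_cond_exp M G (indicator A) x)\<^sup>2 \<partial>M)
      = (\<integral>x. (real_cond_exp M G (real_cond_exp M H (indicator A)) x)\<^sup>2 \<partial>M)"
    using real_cond_exp_tower[OF assms] by (intro integral_cong_AE) auto
  also have "\<dots> \<le> (\<integral>x. (real_cond_exp M H (indicator A) x)\<^sup>2 \<partial>M)"
    using real_cond_exp_indicator_bounds[OF H(1) Am] by (intro energy_real_cond_exp_le G) auto
  finally show ?thesis by (simp add: variance_real_cond_exp_indicator Am G H)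
qed

text \<open>The contraction of second moments, applied to the indicator itself; this is the source
  of the bound \<xi> \<le> 1.\<close>

lemma (in prob_space) variance_real_cond_exp_le_indicator:
  assumes F: "subalgebra M F" and A: "A \<in> events"
  shows "variance (real_cond_exp M F (indicator A)) \<le> variance (indicator A)"
proof -
  interpret F: sigma_finite_subalgebra M F by (rule sigma_finite_subalgebraI) fact
  have "(\<integral>x. (real_cond_exp M F (indicator A) x)\<^sup>2 \<partial>M) \<le> (\<integral>x. (indicator A x)\<^sup>2 \<partial>M)"
    using A by (intro energy_real_cond_exp_le F) (auto simp: indicator_def)
  moreover have "(\<lambda>x. (indicator A x :: real)\<^sup>2) = indicator A" by (auto simp: indicator_def)
  ultimately have "(\<integral>x. (real_cond_exp M F (indicator A) x)\<^sup>2 \<partial>M) \<le> prob A"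
    using A by simp
  then show ?thesis
    unfolding variance_real_cond_exp_indicator[OF F A] variance_indicator[OF A] by simp
qed

section \<open>Integrability in the threshold\<close>

text \<open>Both variances in \<xi> have this form, with \<open>g\<close> the probability that U
  \<ge> y and \<open>f\<close> either the same function or the second moment of the conditional
  probability. The difference need not be monotone, but each term is built from a monotone, hence
  Borel, function, and it is bounded by 1.\<close>

lemma integrable_antimono_diff_squares:
  assumes N: "prob_space N" "sets N = sets borel"
    and f: "antimono (f :: real \<Rightarrow> real)" "\<And>y. 0 \<le> f y \<and> f y \<le> 1"
    and g: "antimono (g :: real \<Rightarrow> real)" "\<And>y. 0 \<le> g y \<and> g y \<le> 1"
  shows "integrable N (\<lambda>y. f y - (g y)\<^sup>2)"
proof -
  interpret N: prob_space N by fact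
  have m: "h \<in> borel_measurable borel" if "antimono h" for h :: "real \<Rightarrow> real"
  proof -
    have "(\<lambda>y. - h y) \<in> borel_measurable borel"
      using that by (intro borel_measurable_mono) (auto simp: monotone_def)
    then have "(\<lambda>y. - (- h y)) \<in> borel_measurable borel" by (rule borel_measurable_uminus)
    then show ?thesis by simp
  qed
  note [measurable] = m[OF f(1)] m[OF g(1)]
  have meas: "(\<lambda>y. f y - (g y)\<^sup>2) \<in> borel_measurable N"
    unfolding measurable_cong_sets[OF N(2) refl] by measurable
  have "norm (f y - (g y)\<^sup>2) \<le> 1" for y
    using f(2)[of y] g(2)[of y] power_le_one[of "g y" 2] by (auto simp: abs_le_iff)
      (smt (verit) zero_le_power2)+
  then show ?thesis by (intro N.integrable_const_bound[OF _ meas]) auto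
qed

lemma (in prob_space) antimono_prob_ge:
  assumes [measurable]: "U \<in> borel_measurable M"
  shows "antimono (\<lambda>y::real. prob {\<omega> \<in> space M. U \<omega> \<ge> y})"
  by (intro antimonoI finite_measure_mono) auto

lemma (in prob_space) integrable_variance_indicator_ge:
  assumes [measurable]: "U \<in> borel_measurable M"
  shows "integrable (distr M borel U) (\<lambda>y::real. variance (indicat_real {\<omega> \<in> space M. U \<omega> \<ge> y}))"
proof -
  have "(\<lambda>y. variance (indicat_real {\<omega> \<in> space M. U \<omega> \<ge> y}))
      = (\<lambda>y. prob {\<omega> \<in> space M. U \<omega> \<ge> y} - (prob {\<omega> \<in> space M. U \<omega> \<ge> y})\<^sup>2)"
    by (intro ext variance_indicator) measurable
  then show ?thesis
    using antimono_prob_ge[OF assms]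
    by (simp only:) (intro integrable_antimono_diff_squares prob_space_distr assms, auto)
qed

text \<open>Conditional probabilities are chosen separately for each \<open>y\<close>, so measurability in \<open>y\<close> is not
  automatic; it holds because both terms of the variance are monotone in \<open>y\<close>.\<close>

lemma (in prob_space) integrable_variance_real_cond_exp_ge:
  assumes U[measurable]: "U \<in> borel_measurable M" and F: "subalgebra M F"
  shows "integrable (distr M borel U)
    (\<lambda>y::real. variance (real_cond_exp M F (indicator {\<omega> \<in> space M. U \<omega> \<ge> y})))"
proof -
  interpret F: sigma_finite_subalgebra M F by (rule sigma_finite_subalgebraI) fact
  define c where "c y = real_cond_exp M F (indicator {\<omega> \<in> space M. U \<omega> \<ge> y})" for y
  have [measurable]: "c y \<in> borel_measurable M" for y by (auto simp: c_def)
  have c01: "AE x in M. 0 \<le> c y x \<and> c y x \<le> 1" for y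
    unfolding c_def by (rule real_cond_exp_indicator_bounds[OF F]) auto
  have int: "integrable M (\<lambda>x. (c y x)\<^sup>2)" for y
    using c01[of y] by (intro integrable_bounded_AE) (auto intro: power_le_one)
  have "antimono (\<lambda>y. \<integral>x. (c y x)\<^sup>2 \<partial>M)"
  proof (rule antimonoI)
    \<comment> \<open>The null set on which the conditional probabilities fail to be ordered may
      depend on the pair \<open>y\<close>, \<open>z\<close>. This is harmless, as only integrals
      over \<open>M\<close> are compared.\<close>
    fix y z :: real assume "y \<le> z"
    then have "AE x in M. c z x \<le> c y x"
      unfolding c_def by (intro F.real_cond_exp_mono) (auto simp: indicator_def emeasure_eq_measure)
    then have "AE x in M. (c z x)\<^sup>2 \<le> (c y x)\<^sup>2"
      using c01[of z] by eventually_elim (auto intro: power_mono)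
    then show "(\<integral>x. (c z x)\<^sup>2 \<partial>M) \<le> (\<integral>x. (c y x)\<^sup>2 \<partial>M)"
      by (intro integral_mono_AE int)
  qed
  moreover have "(\<integral>x. (c y x)\<^sup>2 \<partial>M) \<le> 1" for y
  proof -
    have "(\<integral>x. (c y x)\<^sup>2 \<partial>M) \<le> (\<integral>x. 1 \<partial>M)"
      using c01[of y] by (intro integral_mono_AE int) (auto intro: power_le_one)
    then show ?thesis by (simp add: prob_space)
  qed
  ultimately have "integrable (distr M borel U)
      (\<lambda>y. (\<integral>x. (c y x)\<^sup>2 \<partial>M) - (prob {\<omega> \<in> space M. U \<omega> \<ge> y})\<^sup>2)"
    using antimono_prob_ge[OF U]
    by (intro integrable_antimono_diff_squares prob_space_distr U) auto
  moreover have "(\<lambda>y. variance (c y))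
      = (\<lambda>y. (\<integral>x. (c y x)\<^sup>2 \<partial>M) - (prob {\<omega> \<in> space M. U \<omega> \<ge> y})\<^sup>2)"
    unfolding c_def by (intro ext variance_real_cond_exp_indicator F) measurable
  ultimately show ?thesis unfolding c_def by (simp only:)
qed

section \<open>Sigma-algebras generated by random vectors\<close>

lemma generated_algebra_measurable:
  assumes "V \<in> M \<rightarrow>\<^sub>M Rn n"
  shows "V \<in> generated_algebra M n V \<rightarrow>\<^sub>M Rn n"
  unfolding generated_algebra_def
  using assms by (intro measurable_vimage_algebra1) (auto simp: measurable_def)

lemma space_generated_algebra [simp]: "space (generated_algebra M n V) = space M"
  by (simp add: generated_algebra_def)

text \<open>Minimality of the generated sigma-algebra, for any \<open>N\<close> on the same space:
  inclusions between sigma-algebras reduce to measurability of the generating vector. For this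
  reason the measurability lemmas below also leave \<open>N\<close> general.\<close>

lemma sets_generated_algebra_subset:
  assumes "V \<in> N \<rightarrow>\<^sub>M Rn n" "space N = space M"
  shows "sets (generated_algebra M n V) \<subseteq> sets N"
  unfolding generated_algebra_def using assms by (intro sets_image_in_sets) auto

lemma subalgebra_generated_algebra:
  "V \<in> M \<rightarrow>\<^sub>M Rn n \<Longrightarrow> subalgebra M (generated_algebra M n V)"
  using sets_generated_algebra_subset[of V M n M] by (simp add: subalgebra_def)

lemma component_measurable:
  "V \<in> N \<rightarrow>\<^sub>M Rn n \<Longrightarrow> j \<in> {1..n} \<Longrightarrow> (\<lambda>\<omega>. V \<omega> j) \<in> borel_measurable N"
  using measurable_compose[OF _ measurable_component_singleton] by fastforce

lemma preceding_measurable: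
  assumes "Y \<in> N \<rightarrow>\<^sub>M Rn q" "i \<in> {1..q}"
  shows "preceding i Y \<in> N \<rightarrow>\<^sub>M Rn (i - 1)"
  unfolding preceding_def[abs_def]
  using assms by (intro measurable_restrict component_measurable[of Y N q]) auto

lemma with_preceding_measurable:
  assumes X: "X \<in> N \<rightarrow>\<^sub>M Rn p" and Y: "preceding i Y \<in> N \<rightarrow>\<^sub>M Rn (i - 1)"
  shows "with_preceding p X i Y \<in> N \<rightarrow>\<^sub>M Rn (p + (i - 1))"
  unfolding with_preceding_def[abs_def]
proof (rule measurable_restrict)
  fix j assume "j \<in> {1..p + (i - 1)}"
  then have "j \<le> p \<and> j \<in> {1..p} \<or> \<not> j \<le> p \<and> j - p \<in> {1..i - 1}" by auto
  then show "(\<lambda>\<omega>. if j \<le> p then X \<omega> j else preceding i Y \<omega> (j - p)) \<in> borel_measurable N"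
    using component_measurable[OF X, of j] component_measurable[OF Y, of "j - p"] by presburger
qed

text \<open>The vector (X, preceding components) generates the join of \<open>FX\<close> and
  \<open>FC\<close>: each block is recovered from its coordinates, and conversely every coordinate
  is measurable for the sigma-algebra generated by the rectangles. The case i = 1 is included, with
  \<open>preceding\<close> constant.\<close>

lemma with_preceding_algebra:
  assumes X: "X \<in> M \<rightarrow>\<^sub>M Rn p" and Y: "preceding i Y \<in> M \<rightarrow>\<^sub>M Rn (i - 1)"
  defines "H \<equiv> generated_algebra M (p + (i - 1)) (with_preceding p X i Y)"
    and "FX \<equiv> generated_algebra M p X"
    and "FC \<equiv> generated_algebra M (i - 1) (preceding i Y)"
  shows "sets FX \<subseteq> sets H" "sets FC \<subseteq> sets H"
    "sets H \<subseteq> sigma_sets (space M) (rectangles FX FC)"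
proof -
  let ?W = "with_preceding p X i Y"
  have W: "?W \<in> H \<rightarrow>\<^sub>M Rn (p + (i - 1))"
    unfolding H_def by (intro generated_algebra_measurable with_preceding_measurable X Y)
  have sp: "space H = space M" by (simp add: H_def)
  have "(\<lambda>\<omega>. \<lambda>j\<in>{1..p}. ?W \<omega> j) \<in> H \<rightarrow>\<^sub>M Rn p"
    by (intro measurable_restrict component_measurable[OF W]) auto
  \<comment> \<open>Values of \<open>X\<close> on the space are extensional, so restricting to the
    index set loses nothing; \<open>preceding\<close> is restricted by definition, so its
    counterpart below holds at every point.\<close>
  moreover have "(\<lambda>j\<in>{1..p}. ?W \<omega> j) = X \<omega>" if "\<omega> \<in> space H" for \<omega>
    using measurable_space[OF X] that
    by (auto simp: sp with_preceding_def space_PiM fun_eq_iff PiE_def extensional_def restrict_def)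
  ultimately have "X \<in> H \<rightarrow>\<^sub>M Rn p" by (simp cong: measurable_cong)
  then show "sets FX \<subseteq> sets H" unfolding FX_def by (rule sets_generated_algebra_subset) (rule sp)
  have "(\<lambda>\<omega>. \<lambda>j\<in>{1..i - 1}. ?W \<omega> (p + j)) \<in> H \<rightarrow>\<^sub>M Rn (i - 1)"
    by (intro measurable_restrict component_measurable[OF W]) auto
  moreover have "(\<lambda>j\<in>{1..i - 1}. ?W \<omega> (p + j)) = preceding i Y \<omega>" for \<omega>
    by (auto simp: with_preceding_def preceding_def fun_eq_iff restrict_def)
  ultimately have "preceding i Y \<in> H \<rightarrow>\<^sub>M Rn (i - 1)" by simp
  then show "sets FC \<subseteq> sets H" unfolding FC_def by (rule sets_generated_algebra_subset) (rule sp)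

  have sub: "subalgebra M FX" "subalgebra M FC"
    unfolding FX_def FC_def by (intro subalgebra_generated_algebra X Y)+
  let ?N = "sigma (space M) (rectangles FX FC)"
  have Pow: "rectangles FX FC \<subseteq> Pow (space M)"
    using rectangles_subset[OF sub] sets.space_closed by blast
  have "S \<in> rectangles FX FC" if "S \<in> sets FX" for S
  proof -
    have "S = S \<inter> space M" using sets.sets_into_space[OF that] by (auto simp: FX_def)
    moreover have "space M \<in> sets FC" using sub(2) by (metis subalgebra_def sets.top)
    ultimately show ?thesis using that unfolding rectangles_def by blast
  qed
  then have NX: "subalgebra ?N FX"
    using Pow by (auto simp: subalgebra_def FX_def)
  have "S \<in> rectangles FX FC" if "S \<in> sets FC" for S
  proof -
    have "S = space M \<inter> S" using sets.sets_into_space[OF that] by (auto simp: FC_def)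
    moreover have "space M \<in> sets FX" using sub(1) by (metis subalgebra_def sets.top)
    ultimately show ?thesis using that unfolding rectangles_def by blast
  qed
  then have NC: "subalgebra ?N FC"
    using Pow by (auto simp: subalgebra_def FC_def)
  have "?W \<in> ?N \<rightarrow>\<^sub>M Rn (p + (i - 1))"
    using generated_algebra_measurable[OF X] generated_algebra_measurable[OF Y]
    by (intro with_preceding_measurable measurable_from_subalg[OF NX] measurable_from_subalg[OF NC])
      (auto simp: FX_def FC_def)
  then have "sets H \<subseteq> sets ?N"
    unfolding H_def by (rule sets_generated_algebra_subset) (simp add: Pow)
  then show "sets H \<subseteq> sigma_sets (space M) (rectangles FX FC)"
    using Pow by simp
qed

section \<open>Monotonicity of \<xi> and data processing for T\<close>

lemma (in prob_space) xi_le_1: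
  assumes U[measurable]: "U \<in> borel_measurable M" and V: "V \<in> M \<rightarrow>\<^sub>M Rn n"
  shows "xi M U n V \<le> 1"
proof -
  note F = subalgebra_generated_algebra[OF V]
  have "(\<integral>y. variance (cprob M {\<omega> \<in> space M. U \<omega> \<ge> y} n V) \<partial>distr M borel U)
      \<le> (\<integral>y. variance (indicat_real {\<omega> \<in> space M. U \<omega> \<ge> y}) \<partial>distr M borel U)"
    unfolding cprob_def
    by (intro integral_mono integrable_variance_real_cond_exp_ge integrable_variance_indicator_ge
        variance_real_cond_exp_le_indicator U F) auto
  moreover have "0 \<le> (\<integral>y. variance (indicat_real {\<omega> \<in> space M. U \<omega> \<ge> y}) \<partial>distr M borel U)"
    by (intro Bochner_Integration.integral_nonneg variance_positive)
  \<comment> \<open>For b = 0 the quotient is 0 by the convention on division.\<close>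
  moreover have "a / b \<le> 1" if "a \<le> b" "0 \<le> b" for a b :: real
    using that by (cases "b = 0") (simp_all add: divide_le_eq_1)
  ultimately show ?thesis unfolding xi_def by blast
qed

text \<open>The denominator depends on \<open>U\<close> alone and is nonnegative, so a comparison of
  variances at each threshold suffices. Integrability of both numerators is essential: a
  non-integrable function would have integral 0 by default.\<close>

lemma (in prob_space) xi_mono:
  assumes U: "U \<in> borel_measurable M" and V: "V \<in> M \<rightarrow>\<^sub>M Rn n" and W: "W \<in> M \<rightarrow>\<^sub>M Rn m"
    and le: "\<And>y. variance (cprob M {\<omega> \<in> space M. U \<omega> \<ge> y} n V)
      \<le> variance (cprob M {\<omega> \<in> space M. U \<omega> \<ge> y} m W)"
  shows "xi M U n V \<le> xi M U m W"
  unfolding xi_def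
proof (rule divide_right_mono[OF integral_mono[OF _ _ le]])
  show "0 \<le> (\<integral>y. variance (indicat_real {\<omega> \<in> space M. U \<omega> \<ge> y}) \<partial>distr M borel U)"
    by (intro Bochner_Integration.integral_nonneg variance_positive)
  show "integrable (distr M borel U) (\<lambda>y. variance (cprob M {\<omega> \<in> space M. U \<omega> \<ge> y} n V))"
    unfolding cprob_def
    by (rule integrable_variance_real_cond_exp_ge[OF U subalgebra_generated_algebra[OF V]])
  show "integrable (distr M borel U) (\<lambda>y. variance (cprob M {\<omega> \<in> space M. U \<omega> \<ge> y} m W))"
    unfolding cprob_def
    by (rule integrable_variance_real_cond_exp_ge[OF U subalgebra_generated_algebra[OF W]])
qed

lemma (in prob_space) xi_with_preceding_le:
  assumes X: "X \<in> M \<rightarrow>\<^sub>M Rn p" and Y: "Y \<in> M \<rightarrow>\<^sub>M Rn q" and Z: "Z \<in> M \<rightarrow>\<^sub>M Rn r"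
    and ci: "cond_indep M q Y r Z p X" and i: "i \<in> {1..q}"
  shows "xi M (\<lambda>\<omega>. Y \<omega> i) (r + (i - 1)) (with_preceding r Z i Y)
    \<le> xi M (\<lambda>\<omega>. Y \<omega> i) (p + (i - 1)) (with_preceding p X i Y)"
proof -
  let ?FY = "generated_algebra M q Y"
  let ?FC = "generated_algebra M (i - 1) (preceding i Y)"
  interpret cond_indep_algebras M "generated_algebra M p X" ?FY "generated_algebra M r Z"
    using ci subalgebra_generated_algebra[OF X] subalgebra_generated_algebra[OF Y]
      subalgebra_generated_algebra[OF Z]
    by unfold_locales (auto simp: cond_indep_def cprob_def)
  have PM: "preceding i Y \<in> M \<rightarrow>\<^sub>M Rn (i - 1)" by (rule preceding_measurable[OF Y i])
  note YY = generated_algebra_measurable[OF Y]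
  \<comment> \<open>Measurability of \<open>preceding i Y\<close> is taken with respect to the
    algebra of \<open>Y\<close> itself, which places the conditioning information inside
    \<open>FY\<close> as the conditional independence argument requires.\<close>
  have FC: "subalgebra ?FY ?FC"
    using sets_generated_algebra_subset[OF preceding_measurable[OF YY i]]
    by (simp add: subalgebra_def)
  note m = with_preceding_measurable[OF X PM] with_preceding_measurable[OF Z PM]
  show ?thesis
  proof (rule xi_mono[OF component_measurable[OF Y i] m(2,1)])
    fix y
    have "{\<omega> \<in> space ?FY. Y \<omega> i \<ge> y} \<in> sets ?FY"
      using component_measurable[OF YY i] by (rule borel_measurable_le[OF borel_measurable_const])
    then show "variance (cprob M {\<omega> \<in> space M. Y \<omega> i \<ge> y} (r + (i - 1)) (with_preceding r Z i Y))
      \<le> variance (cprob M {\<omega> \<in> space M. Y \<omega> i \<ge> y} (p + (i - 1)) (with_preceding p X i Y))"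
      unfolding cprob_def
      using with_preceding_algebra[OF X PM] with_preceding_algebra(3)[OF Z PM] m
      by (intro variance_real_cond_exp_le[OF FC] subalgebra_generated_algebra) auto
  qed
qed

lemma (in prob_space) T_dep_data_processing:
  assumes X: "X \<in> M \<rightarrow>\<^sub>M Rn p" and Y: "Y \<in> M \<rightarrow>\<^sub>M Rn q" and Z: "Z \<in> M \<rightarrow>\<^sub>M Rn r"
    and ci: "cond_indep M q Y r Z p X"
  shows "T_dep M q Y r Z \<le> T_dep M q Y p X"
proof -
  \<comment> \<open>Each summand is at most 1, the first being 0 by convention. This makes the
    denominator of \<open>T_dep\<close> nonnegative, which is enough: if it vanished, both quotients
    would be 0.\<close>
  have "(\<Sum>i = 1..q. if i = 1 then 0 else xi M (\<lambda>\<omega>. Y \<omega> i) (i - 1) (preceding i Y)) \<le> (\<Sum>i = 1..q. 1)"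
    using component_measurable[OF Y] preceding_measurable[OF Y]
    by (intro sum_mono) (auto intro!: xi_le_1)
  then have "0 \<le> real q - (\<Sum>i = 1..q. if i = 1 then 0 else xi M (\<lambda>\<omega>. Y \<omega> i) (i - 1) (preceding i Y))"
    by simp
  then show ?thesis
    unfolding T_dep_def
    by (intro diff_left_mono divide_right_mono sum_mono xi_with_preceding_le[OF X Y Z ci])
qed

text \<open>An event \<open>B\<close> determined by h(X) lies in the sigma-algebra of
  \<open>X\<close>. Its indicator is therefore its own conditional probability, and it can be pulled
  out of the conditional probability of A \<inter> B.\<close>

lemma (in prob_space) cond_indep_function:
  assumes X: "X \<in> M \<rightarrow>\<^sub>M Rn p" and Y: "Y \<in> M \<rightarrow>\<^sub>M Rn q" and h: "h \<in> Rn p \<rightarrow>\<^sub>M Rn s"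
  shows "cond_indep M q Y s (\<lambda>\<omega>. h (X \<omega>)) p X"
  unfolding cond_indep_def cprob_def
proof (intro ballI)
  let ?F = "generated_algebra M p X"
  note F = subalgebra_generated_algebra[OF X]
  interpret F: sigma_finite_subalgebra M ?F by (rule sigma_finite_subalgebraI) (rule F)
  fix A B assume A: "A \<in> sets (generated_algebra M q Y)"
    and B: "B \<in> sets (generated_algebra M s (\<lambda>\<omega>. h (X \<omega>)))"
  have [measurable]: "A \<in> events"
    using A subalgebra_generated_algebra[OF Y] by (auto simp: subalgebra_def)
  have "(\<lambda>\<omega>. h (X \<omega>)) \<in> ?F \<rightarrow>\<^sub>M Rn s"
    by (rule measurable_compose[OF generated_algebra_measurable[OF X] h])
  then have "sets (generated_algebra M s (\<lambda>\<omega>. h (X \<omega>))) \<subseteq> sets ?F"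
    by (rule sets_generated_algebra_subset) simp
  then have BF[measurable]: "B \<in> sets ?F" using B by auto
  then have [measurable]: "B \<in> events" using F by (auto simp: subalgebra_def)
  have AB: "(\<lambda>x. indicator B x * indicator A x :: real) = indicator (A \<inter> B)"
    by (auto simp: indicator_def)
  have "AE x in M. real_cond_exp M ?F (\<lambda>x. indicator B x * indicator A x) x
      = indicator B x * real_cond_exp M ?F (indicator A) x"
    by (rule F.real_cond_exp_mult) (auto simp: AB emeasure_eq_measure)
  moreover have "AE x in M. real_cond_exp M ?F (indicator B) x = indicator B x"
    by (rule F.real_cond_exp_F_meas) (auto simp: emeasure_eq_measure)
  ultimately show "AE x in M. real_cond_exp M ?F (indicator (A \<inter> B)) x
      = real_cond_exp M ?F (indicator A) x * real_cond_exp M ?F (indicator B) x"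
    unfolding AB by eventually_elim simp
qed

theorem corollary2p2:
  fixes M :: "'a measure" and p q :: nat and X Y :: "'a \<Rightarrow> nat \<Rightarrow> real"
  assumes "prob_space M"
    and "p \<ge> 1" and "q \<ge> 1"
    and "X \<in> M \<rightarrow>\<^sub>M Rn p" and "Y \<in> M \<rightarrow>\<^sub>M Rn q"
    and "\<forall>i\<in>{1..q}. nondegenerate M (\<lambda>\<omega>. Y \<omega> i)"
  shows "(\<forall>r\<ge>1. \<forall>Z \<in> M \<rightarrow>\<^sub>M Rn r.
            cond_indep M q Y r Z p X \<longrightarrow> T_dep M q Y r Z \<le> T_dep M q Y p X) \<and>
         (\<forall>s\<ge>1. \<forall>h \<in> Rn p \<rightarrow>\<^sub>M Rn s.
            T_dep M q Y s (\<lambda>\<omega>. h (X \<omega>)) \<le> T_dep M q Y p X)"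
proof -
  interpret prob_space M by fact
  show ?thesis
  proof (intro conjI allI impI ballI)
    show "T_dep M q Y r Z \<le> T_dep M q Y p X"
      if "Z \<in> M \<rightarrow>\<^sub>M Rn r" "cond_indep M q Y r Z p X" for r Z
      using that by (rule T_dep_data_processing[OF assms(4,5)])
    show "T_dep M q Y s (\<lambda>\<omega>. h (X \<omega>)) \<le> T_dep M q Y p X"
      if "h \<in> Rn p \<rightarrow>\<^sub>M Rn s" for s h
      by (rule T_dep_data_processing[OF assms(4,5) measurable_compose[OF assms(4) that]
            cond_indep_function[OF assms(4,5) that]])
  qed
qed

end
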